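(* Let $q \ge 3$ be a prime power. There exists an absolutely irreducible plane projective cubic curve defined over $\mathbb{F}_{q^2}$ that intersects the Hermitian curve $\mathcal{H}_q$ in $3(q+1)$ distinct $\mathbb{F}_{q^2}$-rational points.
   Context: The Hermitian curve $\mathcal{H}_q\subset\mathbb{P}^2$ over $\mathbb{F}_{q^2}$ is given by $X^{q+1}+Y^{q+1}+Z^{q+1}=0$ (it is projectively equivalent over $\mathbb{F}_{q^2}$ to the curve $Y^qZ+YZ^q=X^{q+1}$). A plane projective curve defined over $\mathbb{F}_{q^2}$ is given by a nonzero homogeneous polynomial in $X,Y,Z$ with coefficients in $\mathbb{F}_{q^2}$; it is absolutely irreducible if this polynomial is irreducible over an algebraic closure of $\mathbb{F}_{q^2}$. *)

theory Defs
  imports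
    "HOL-Algebra.Algebraic_Closure_Type"
    "HOL-Number_Theory.Prime_Powers"
begin

(* The polynomial ring K[X,Y,Z] is represented as K[X][Y][Z]: in
   F :: 'a poly poly poly the outermost variable is Z and the innermost one is X. *)

type_synonym 'a poly3 = "'a poly poly poly"

definition coeff3 :: "'a::zero poly3 \<Rightarrow> nat \<Rightarrow> nat \<Rightarrow> nat \<Rightarrow> 'a" where
  "coeff3 F i j k = coeff (coeff (coeff F k) j) i"

definition Xvar :: "'a::comm_semiring_1 poly3" where "Xvar = [:[:[:0, 1:]:]:]"
definition Yvar :: "'a::comm_semiring_1 poly3" where "Yvar = [:[:0, 1:]:]"
definition Zvar :: "'a::comm_semiring_1 poly3" where "Zvar = [:0, 1:]"

fun eval3 :: "'a::comm_semiring_1 poly3 \<Rightarrow> 'a \<times> 'a \<times> 'a \<Rightarrow> 'a" where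
  "eval3 F (x, y, z) = poly (poly (poly F [:[:z:]:]) [:y:]) x"

definition map_poly3 :: "('a::zero \<Rightarrow> 'b::zero) \<Rightarrow> 'a poly3 \<Rightarrow> 'b poly3" where
  "map_poly3 h = map_poly (map_poly (map_poly h))"

definition homogeneous3 :: "nat \<Rightarrow> 'a::zero poly3 \<Rightarrow> bool" where
  "homogeneous3 d F \<longleftrightarrow> (\<forall>i j k. coeff3 F i j k \<noteq> 0 \<longrightarrow> i + j + k = d)"

definition plane_curve :: "nat \<Rightarrow> 'a::zero poly3 \<Rightarrow> bool" where
  "plane_curve d F \<longleftrightarrow> F \<noteq> 0 \<and> homogeneous3 d F"

definition absolutely_irreducible :: "'a::field poly3 \<Rightarrow> bool" where
  "absolutely_irreducible F \<longleftrightarrow> irreducible (map_poly3 to_ac F :: 'a alg_closure poly3)"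

definition proj_rel :: "(('a::field \<times> 'a \<times> 'a) \<times> ('a \<times> 'a \<times> 'a)) set" where
  "proj_rel = {((x, y, z), (x', y', z')).
     (x, y, z) \<noteq> (0, 0, 0) \<and> (\<exists>c. c \<noteq> 0 \<and> x' = c * x \<and> y' = c * y \<and> z' = c * z)}"

definition proj_plane :: "('a::field \<times> 'a \<times> 'a) set set" where
  "proj_plane = (UNIV - {(0, 0, 0)}) // proj_rel"

(* The points with coordinates in the coefficient field 'a itself. *)
definition rational_points :: "'a::field poly3 \<Rightarrow> ('a \<times> 'a \<times> 'a) set set" where
  "rational_points F = {P \<in> proj_plane. \<forall>v\<in>P. eval3 F v = 0}"

definition hermitian_form :: "nat \<Rightarrow> 'a::comm_semiring_1 poly3" where
  "hermitian_form q = Xvar ^ (q + 1) + Yvar ^ (q + 1) + Zvar ^ (q + 1)"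

end

theory Submission
  imports Defs "HOL-Number_Theory.Residues"
begin

text \<open>
  All cubics used have the shape \<open>L Z\<^sup>2 + m X L Z + C(X, Y)\<close> with a linear form \<open>L = Y + c X\<close>
  not dividing \<open>C\<close>; an Eisenstein-type argument at the prime \<open>L\<close> makes them irreducible.

  For \<open>q \<ge> 8\<close> take \<open>Y Z\<^sup>2 = a X\<^sup>3\<close>. On the chart \<open>Z = 1\<close> its intersection with the Hermitian
  curve is \<open>A n\<^sup>3 + n + 1 = 0\<close> with \<open>n = x\<^bsup>q+1\<^esup>\<close> and \<open>A = a\<^bsup>q+1\<^esup>\<close>, both norms to \<open>F\<^sub>q\<close>. Each nonzero
  element of \<open>F\<^sub>q\<close> is the norm of exactly \<open>q + 1\<close> elements, so it suffices that the trinomial has three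
  distinct roots in \<open>F\<^sub>q\<close>. Up to scaling this asks for \<open>1/n\<^sub>1, 1/n\<^sub>2, 1/n\<^sub>3\<close> with vanishing second
  symmetric function, for example proportional to \<open>1, s, -s/(1+s)\<close>, and at most seven values of
  \<open>s\<close> are degenerate. The remaining values \<open>q = 3, 4, 5, 7\<close> are settled by explicit cubics, found by
  a computer search.
\<close>

section \<open>Irreducible cubics and common points of plane curves\<close>

declare eval3.simps [simp del]

text \<open>The middle coefficient stays a product of \<open>Y + c * X\<close> and
  \<open>m * X\<close>, so that unfolding gives the shape \<open>[:C, L * M, L:]\<close> of
  \<open>irreducible_quadratic\<close>.\<close>

definition cubic :: "'a::comm_ring_1 \<Rightarrow> 'a \<Rightarrow> 'a \<Rightarrow> 'a \<Rightarrow> 'a \<Rightarrow> 'a \<Rightarrow> 'a poly3" where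
  "cubic c m c0 c1 c2 c3 =
     [:[:[:0, 0, 0, c0:], [:0, 0, c1:], [:0, c2:], [:c3:]:],
       [:[:0, c:], 1:] * [:[:0, m:]:],
       [:[:0, c:], 1:]:]"

lemma eval3_cubic [simp]:
  "eval3 (cubic c m c0 c1 c2 c3) (x, y, z) =
     (y + c * x) * z ^ 2 + m * x * (y + c * x) * z
       + c0 * x ^ 3 + c1 * x ^ 2 * y + c2 * x * y ^ 2 + c3 * y ^ 3"
  by (simp add: eval3.simps cubic_def algebra_simps power2_eq_square power3_eq_cube)

lemma eval3_hermitian_form [simp]:
  "eval3 (hermitian_form q) (x, y, z) = x ^ (q + 1) + y ^ (q + 1) + z ^ (q + 1)"
  by (simp add: eval3.simps hermitian_form_def Xvar_def Yvar_def Zvar_def)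

lemma plane_curve_cubic: "plane_curve 3 (cubic c m c0 c1 c2 c3)"
  by (auto simp: plane_curve_def homogeneous3_def coeff3_def cubic_def coeff_pCons
           split: nat.splits)

lemma map_poly3_cubic:
  "map_poly3 to_ac (cubic c m c0 c1 c2 c3) =
     cubic (to_ac c) (to_ac m) (to_ac c0) (to_ac c1) (to_ac c2) (to_ac c3)"
  by (simp add: map_poly3_def cubic_def map_poly_pCons)

section \<open>Irreducibility of the cubics over the algebraic closure\<close>

lemma prime_elem_monic_linear:
  fixes a :: "'a::idom"
  shows "prime_elem [:- a, 1:]"
proof (rule prime_elemI)
  show "[:- a, 1:] \<noteq> 0" "\<not> [:- a, 1:] dvd 1"
    by (auto simp: is_unit_poly_iff)
  show "[:- a, 1:] dvd f \<or> [:- a, 1:] dvd g" if "[:- a, 1:] dvd f * g" for f g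
    using that by (simp flip: poly_eq_0_iff_dvd)
qed

text \<open>Eisenstein's criterion with the coefficients read backwards: the prime \<open>L\<close>
  divides the two upper coefficients, \<open>L ^ 2\<close> does not divide the leading one, and
  \<open>L\<close> does not divide the constant one.\<close>

lemma irreducible_quadratic:
  fixes L M C :: "'a::{idom_divide,algebraic_semidom}"
  assumes L: "prime_elem L" and C: "\<not> L dvd C"
  shows "irreducible [:C, L * M, L:]"
proof (rule irreducibleI)
  from L have L0: "L \<noteq> 0" by auto
  then show "[:C, L * M, L:] \<noteq> 0" by simp
  from L0 show "\<not> [:C, L * M, L:] dvd 1" by (auto simp: is_unit_poly_iff)
  \<comment> \<open>A constant factor \<open>g\<close> divides both \<open>L\<close> and
    \<open>C\<close>. If it were not a unit, it would be associated to the irreducible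
    \<open>L\<close>, and \<open>L\<close> would divide \<open>C\<close>.\<close>
  have const: "is_unit G" if "degree G = 0" "[:C, L * M, L:] = G * H" for G H
  proof -
    from that(1) obtain g where g: "G = [:g:]" by (auto elim: degree_eq_zeroE)
    with that(2) have *: "smult g H = [:C, L * M, L:]" by simp
    have gC: "g dvd C" by (metis * coeff_pCons_0 coeff_smult dvd_triv_left)
    have "coeff [:C, L * M, L:] 2 = L" by (simp add: numeral_2_eq_2)
    with * have "L = g * coeff H 2" by (metis coeff_smult)
    moreover from L have "irreducible L" by (rule prime_elem_imp_irreducible)
    ultimately consider "is_unit g" | "is_unit (coeff H 2)" by (meson irreducibleD)
    then have "is_unit g"
    proof cases
      case 2
      then have "L dvd g"
        using \<open>L = g * coeff H 2\<close> by (metis dvd_refl mult_unit_dvd_iff)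
      with gC C show ?thesis using dvd_trans by blast
    qed
    then show ?thesis using g by (simp add: is_unit_const_poly_iff)
  qed
  show "is_unit G \<or> is_unit H" if GH: "[:C, L * M, L:] = G * H" for G H
  proof (cases "degree G = 0 \<or> degree H = 0")
    case True
    then show ?thesis using const GH by (metis mult.commute)
  next
    case False
    from GH L0 have "G \<noteq> 0" "H \<noteq> 0" by auto
    then have "degree G + degree H = 2"
      using GH L0 by (metis degree_mult_eq degree_pCons_eq degree_pCons_0 numeral_2_eq_2
          pCons_eq_0_iff)
    with False have d: "degree G = 1" "degree H = 1" by auto
    have linear: "\<exists>b a. P = [:b, a:]" if "degree P = 1" for P :: "'a poly"
      using that by (cases P) (auto split: if_splits elim!: degree_eq_zeroE)
    obtain b a where G: "G = [:b, a:]" using linear[OF d(1)] by blast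
    obtain d e where H: "H = [:d, e:]" using linear[OF d(2)] by blast
    from GH have eqs: "C = b * d" "L * M = a * d + b * e" "L = a * e"
      by (auto simp: G H algebra_simps)
    have sum: "L dvd a * d + b * e" by (metis dvd_triv_left eqs(2))
    \<comment> \<open>If \<open>L\<close> divides one of the two factors of
      \<open>L = a * e\<close>, the other one is a unit and can be cancelled from the middle
      coefficient.\<close>
    have unit: "v dvd 1" if "L = u * v" "L dvd u" for u v
    proof -
      from that obtain k where "L = L * k * v" by (metis dvdE)
      with L0 show ?thesis by (metis dvd_triv_right mult.assoc mult.right_neutral mult_left_cancel)
    qed
    have "L dvd a \<or> L dvd e" using L eqs(3) by (metis dvd_refl prime_elem_dvd_multD)
    then have "L dvd C"
    proof
      assume a: "L dvd a"
      then have "L dvd b * e" using sum by (simp add: dvd_add_right_iff)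
      then have "L dvd b" using unit[OF eqs(3) a] by (simp add: dvd_mult_unit_iff)
      then show ?thesis using eqs(1) by simp
    next
      assume e: "L dvd e"
      then have "L dvd d * a" using sum by (simp add: dvd_add_left_iff mult.commute)
      then have "L dvd d" using unit[of e a] e eqs(3)
        by (metis dvd_mult_unit_iff mult.commute)
      then show ?thesis using eqs(1) by simp
    qed
    with C show ?thesis by simp
  qed
qed

text \<open>The nonvanishing expression is the value of the binary cubic form at
  \<open>(1, - c)\<close>, where \<open>Y + c * X\<close> vanishes. It therefore says that this
  linear form does not divide the binary form, and it survives the embedding into the
  closure.\<close>

lemma absolutely_irreducible_cubic:
  fixes c :: "'a::field"
  assumes "c0 - c1 * c + c2 * c ^ 2 - c3 * c ^ 3 \<noteq> 0"
  shows "absolutely_irreducible (cubic c m c0 c1 c2 c3)"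
proof -
  have irr: "irreducible (cubic d n d0 d1 d2 d3)"
    if "d0 - d1 * d + d2 * d ^ 2 - d3 * d ^ 3 \<noteq> 0" for d n d0 d1 d2 d3 :: "'a alg_closure"
    unfolding cubic_def
  proof (rule irreducible_quadratic)
    let ?C = "[:[:0, 0, 0, d0:], [:0, 0, d1:], [:0, d2:], [:d3:]:]"
    have L: "[:[:0, d:], 1:] = [:- [:0, - d:], 1:]" by simp
    show "prime_elem [:[:0, d:], 1:]"
      unfolding L by (rule prime_elem_monic_linear)
    have "coeff (poly ?C [:0, - d:]) 3 = d0 - d1 * d + d2 * d ^ 2 - d3 * d ^ 3"
      by (simp add: numeral_3_eq_3 power2_eq_square power3_eq_cube algebra_simps)
    with that have "poly ?C [:0, - d:] \<noteq> 0" by (metis coeff_0)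
    then show "\<not> [:[:0, d:], 1:] dvd ?C"
      unfolding L by (simp only: poly_eq_0_iff_dvd not_False_eq_True)
  qed
  have "to_ac (c0 - c1 * c + c2 * c ^ 2 - c3 * c ^ 3) \<noteq> 0"
    using assms by (metis to_ac_0 to_ac_eq_iff)
  then show ?thesis
    unfolding absolutely_irreducible_def map_poly3_cubic by (intro irr) simp
qed

text \<open>Every common point off the line \<open>l = 0\<close> has a unique representative with \<open>l = 1\<close>.\<close>

lemma card_common_points:
  fixes F G :: "'a::field poly3" and l :: "'a \<times> 'a \<times> 'a \<Rightarrow> 'a"
  assumes F: "\<And>t x y z. eval3 F (t * x, t * y, t * z) = t ^ d * eval3 F (x, y, z)"
    and G: "\<And>t x y z. eval3 G (t * x, t * y, t * z) = t ^ e * eval3 G (x, y, z)"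
    and l: "\<And>t x y z. l (t * x, t * y, t * z) = t * l (x, y, z)"
    and off: "\<And>v. eval3 F v = 0 \<Longrightarrow> eval3 G v = 0 \<Longrightarrow> l v = 0 \<Longrightarrow> v = (0, 0, 0)"
  shows "card (rational_points F \<inter> rational_points G)
       = card {v. l v = 1 \<and> eval3 F v = 0 \<and> eval3 G v = 0}"
proof -
  let ?S = "{v. l v = 1 \<and> eval3 F v = 0 \<and> eval3 G v = 0}"
  have l0: "l (0, 0, 0) = 0" using l[of 0 0 0 0] by simp
  have cls: "proj_rel `` {(x, y, z)} = {(t * x, t * y, t * z) |t. t \<noteq> 0}"
    if "(x, y, z) \<noteq> (0, 0, 0)" for x y z :: 'a
    using that by (auto simp: proj_rel_def Image_def)
  have inj: "inj_on (\<lambda>v. proj_rel `` {v}) ?S"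
  proof (rule inj_onI)
    fix v w assume "v \<in> ?S" "w \<in> ?S" and vw: "proj_rel `` {v} = proj_rel `` {w}"
    obtain x y z x' y' z' where v: "v = (x, y, z)" and w: "w = (x', y', z')"
      by (metis prod_cases3)
    have 1: "l (x, y, z) = 1" "l (x', y', z') = 1"
      and eq: "proj_rel `` {(x, y, z)} = proj_rel `` {(x', y', z')}"
      using \<open>v \<in> ?S\<close> \<open>w \<in> ?S\<close> vw by (auto simp: v w)
    have nz: "(x, y, z) \<noteq> (0, 0, 0)" "(x', y', z') \<noteq> (0, 0, 0)"
      using 1 l0 by (metis zero_neq_one)+
    have "(x, y, z) \<in> {(t * x, t * y, t * z) |t. t \<noteq> 0}"
      by (auto intro!: exI[of _ 1])
    then obtain t where t: "(x, y, z) = (t * x', t * y', t * z')"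
      using eq unfolding cls[OF nz(1)] cls[OF nz(2)] by blast
    then have "t = 1" using 1 l[of t x' y' z'] by simp
    with t show "v = w" by (simp add: v w)
  qed
  have "rational_points F \<inter> rational_points G = (\<lambda>v. proj_rel `` {v}) ` ?S"
  proof (intro equalityI subsetI)
    fix P assume P: "P \<in> rational_points F \<inter> rational_points G"
    then have "P \<in> (UNIV - {(0, 0, 0)}) // proj_rel"
      by (simp add: rational_points_def proj_plane_def)
    then obtain x y z where nz: "(x, y, z) \<noteq> (0, 0, 0)" and "P = proj_rel `` {(x, y, z)}"
      by (auto elim!: quotientE)
    then have PP: "P = {(t * x, t * y, t * z) |t. t \<noteq> 0}" using cls by simp
    then have "(x, y, z) \<in> P" by (auto intro!: exI[of _ 1])
    then have "eval3 F (x, y, z) = 0" "eval3 G (x, y, z) = 0"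
      using P by (auto simp: rational_points_def)
    then have lz: "l (x, y, z) \<noteq> 0" using off nz by blast
    define k where "k = inverse (l (x, y, z))"
    have k: "k \<noteq> 0" using lz by (simp add: k_def)
    have "(k * x, k * y, k * z) \<in> ?S"
      using F[of k x y z] G[of k x y z] l[of k x y z] \<open>eval3 F (x, y, z) = 0\<close>
        \<open>eval3 G (x, y, z) = 0\<close> lz by (simp add: k_def)
    moreover have "proj_rel `` {(k * x, k * y, k * z)} = P"
    proof -
      have "(k * x, k * y, k * z) \<noteq> (0, 0, 0)" using k nz by auto
      then have "proj_rel `` {(k * x, k * y, k * z)} =
          {(t * (k * x), t * (k * y), t * (k * z)) |t. t \<noteq> 0}" by (rule cls)
      also have "\<dots> = P"
        unfolding PP
      proof (intro equalityI subsetI; clarify)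
        fix t :: 'a assume "t \<noteq> 0"
        then show "\<exists>s. (t * (k * x), t * (k * y), t * (k * z)) = (s * x, s * y, s * z) \<and> s \<noteq> 0"
          using k by (intro exI[of _ "t * k"]) (simp add: mult.assoc)
      next
        fix t :: 'a assume "t \<noteq> 0"
        then show "\<exists>s. (t * x, t * y, t * z) = (s * (k * x), s * (k * y), s * (k * z)) \<and> s \<noteq> 0"
          using k by (intro exI[of _ "t / k"]) simp
      qed
      finally show ?thesis .
    qed
    ultimately show "P \<in> (\<lambda>v. proj_rel `` {v}) ` ?S" by blast
  next
    fix P assume "P \<in> (\<lambda>v. proj_rel `` {v}) ` ?S"
    then obtain x y z where v: "(x, y, z) \<in> ?S" and P: "P = proj_rel `` {(x, y, z)}" by auto
    have nz: "(x, y, z) \<noteq> (0, 0, 0)" using v l0 by auto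
    then have "P \<in> proj_plane" unfolding P proj_plane_def by (intro quotientI) simp
    then show "P \<in> rational_points F \<inter> rational_points G"
      using v F G unfolding P cls[OF nz] by (auto simp: rational_points_def)
  qed
  then show ?thesis using card_image[OF inj] by simp
qed

section \<open>Counting the intersection with the Hermitian curve in an affine chart\<close>

text \<open>The form \<open>l\<close> is left open because both charts \<open>y = 1\<close> and
  \<open>z = 1\<close> occur below. The second assumption says that no common point lies on the line
  \<open>l = 0\<close>.\<close>

lemma card_cubic_hermitian:
  fixes c :: "'a::field" and l :: "'a \<times> 'a \<times> 'a \<Rightarrow> 'a"
  assumes l: "\<And>t x y z. l (t * x, t * y, t * z) = t * l (x, y, z)"
    and "\<And>x y z. eval3 (cubic c m c0 c1 c2 c3) (x, y, z) = 0 \<Longrightarrow>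
           x ^ (q + 1) + y ^ (q + 1) + z ^ (q + 1) = 0 \<Longrightarrow> l (x, y, z) = 0 \<Longrightarrow>
           x = 0 \<and> y = 0 \<and> z = 0"
  shows "card (rational_points (cubic c m c0 c1 c2 c3) \<inter> rational_points (hermitian_form q))
       = card {(x, y, z). l (x, y, z) = 1 \<and> eval3 (cubic c m c0 c1 c2 c3) (x, y, z) = 0 \<and>
                x ^ (q + 1) + y ^ (q + 1) + z ^ (q + 1) = 0}"
proof -
  have "card (rational_points (cubic c m c0 c1 c2 c3) \<inter> rational_points (hermitian_form q))
      = card {v. l v = 1 \<and> eval3 (cubic c m c0 c1 c2 c3) v = 0 \<and> eval3 (hermitian_form q) v = 0}"
  proof (rule card_common_points[where d = 3 and e = "q + 1", OF _ _ l])
    show "eval3 (cubic c m c0 c1 c2 c3) (t * x, t * y, t * z) =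
        t ^ 3 * eval3 (cubic c m c0 c1 c2 c3) (x, y, z)" for t x y z
      by (simp add: algebra_simps power2_eq_square power3_eq_cube)
    show "eval3 (hermitian_form q) (t * x, t * y, t * z) =
        t ^ (q + 1) * eval3 (hermitian_form q) (x, y, z)" for t x y z
      by (simp add: algebra_simps)
    show "v = (0, 0, 0)" if "eval3 (cubic c m c0 c1 c2 c3) v = 0"
        "eval3 (hermitian_form q) v = 0" "l v = 0" for v
    proof -
      obtain x y z where v: "v = (x, y, z)" by (rule prod_cases3)
      show ?thesis
        using that assms(2)[of x y z] by (simp only: v eval3_hermitian_form)
    qed
  qed
  also have "{v. l v = 1 \<and> eval3 (cubic c m c0 c1 c2 c3) v = 0 \<and> eval3 (hermitian_form q) v = 0}
      = {(x, y, z). l (x, y, z) = 1 \<and> eval3 (cubic c m c0 c1 c2 c3) (x, y, z) = 0 \<and>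
                x ^ (q + 1) + y ^ (q + 1) + z ^ (q + 1) = 0}"
    by (simp only: eval3_hermitian_form case_prod_unfold prod.collapse flip: eval3_hermitian_form)
  finally show ?thesis .
qed

text \<open>On the line \<open>y = 0\<close> the cubic reduces to \<open>c0 * x ^ 3\<close>, so
  \<open>x = 0\<close>, and the Hermitian equation then gives \<open>z = 0\<close>. Hence all common
  points lie in the chart \<open>y = 1\<close>.\<close>

lemma card_cubic_hermitian_affine:
  fixes m :: "'a::field"
  assumes "c0 \<noteq> 0"
  shows "card (rational_points (cubic 0 m c0 c1 c2 c3) \<inter> rational_points (hermitian_form q))
       = card {(x, z). z ^ 2 + m * x * z + c0 * x ^ 3 + c1 * x ^ 2 + c2 * x + c3 = 0 \<and>
                x ^ (q + 1) + 1 + z ^ (q + 1) = 0}"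
    (is "_ = card ?A")
proof -
  have "card (rational_points (cubic 0 m c0 c1 c2 c3) \<inter> rational_points (hermitian_form q)) =
      card {(x, y, z). (\<lambda>(x, y, z). y) (x, y, z) = 1 \<and>
        eval3 (cubic 0 m c0 c1 c2 c3) (x, y, z) = 0 \<and> x ^ (q + 1) + y ^ (q + 1) + z ^ (q + 1) = 0}"
    by (rule card_cubic_hermitian) (use assms in auto)
  also have "{(x, y, z). (\<lambda>(x, y, z). y) (x, y, z) = 1 \<and>
        eval3 (cubic 0 m c0 c1 c2 c3) (x, y, z) = 0 \<and> x ^ (q + 1) + y ^ (q + 1) + z ^ (q + 1) = 0}
      = (\<lambda>(x, z). (x, 1, z)) ` ?A"
    by (auto simp: image_iff)
  also have "card \<dots> = card ?A" by (rule card_image) (auto simp: inj_on_def)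
  finally show ?thesis .
qed

section \<open>Power maps on finite fields\<close>

text \<open>Multiplication by \<open>x\<close> permutes the nonzero elements, so their product is
  unchanged by one factor \<open>x\<close> for each of them.\<close>

lemma power_card_minus_one:
  fixes x :: "'a::{field,finite}"
  assumes "x \<noteq> 0"
  shows "x ^ (card (UNIV :: 'a set) - 1) = 1"
proof -
  let ?U = "UNIV - {0 :: 'a}"
  have "bij_betw ((*) x) ?U ?U"
    using assms by (intro bij_betwI[of _ _ _ "\<lambda>y. y / x"]) auto
  then have "\<Prod>?U = (\<Prod>y\<in>?U. x * y)"
    by (rule prod.reindex_bij_betw[symmetric])
  also have "\<dots> = x ^ card ?U * \<Prod>?U"
    by (simp add: prod.distrib)
  finally show ?thesis
    by (simp add: card_Diff_singleton)
qed

lemma card_power_eq_le: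
  fixes y :: "'a::field"
  assumes "n > 0"
  shows "card {x. x ^ n = y} \<le> n"
proof -
  have deg: "degree (monom 1 n - [:y:]) = n"
    using assms degree_add_eq_left[of "[:- y:]" "monom 1 n"]
    unfolding diff_conv_add_uminus by (simp add: degree_monom_eq)
  then have nz: "monom 1 n - [:y:] \<noteq> 0" using assms by auto
  have "{x. x ^ n = y} = {x. poly (monom 1 n - [:y:]) x = 0}"
    by (simp add: poly_monom)
  then show ?thesis using card_poly_roots_bound[OF nz] deg by simp
qed

text \<open>The map \<open>x \<mapsto> x ^ b\<close> sends the \<open>a * b\<close> units into the at most \<open>a\<close> roots of
  \<open>y ^ a = 1\<close> with fibres of size at most \<open>b\<close>, so both bounds are attained.\<close>

lemma card_power_eq:
  fixes y :: "'a::{field,finite}"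
  assumes card: "card (UNIV :: 'a set) = a * b + 1" and pos: "a > 0" "b > 0" and y: "y ^ a = 1"
  shows "card {x. x ^ b = y} = b"
proof (rule ccontr)
  assume "card {x. x ^ b = y} \<noteq> b"
  then have less: "card {x. x ^ b = y} < b"
    using card_power_eq_le[OF pos(2), of y] by simp
  let ?R = "{w :: 'a. w ^ a = 1}"
  have "UNIV - {0} \<subseteq> (\<Union>w\<in>?R. {x. x ^ b = w})"
  proof
    fix x :: 'a assume "x \<in> UNIV - {0}"
    then have "x ^ (a * b) = 1" using power_card_minus_one[of x] card by simp
    then have "(x ^ b) ^ a = 1" by (simp add: mult.commute flip: power_mult)
    then show "x \<in> (\<Union>w\<in>?R. {x. x ^ b = w})" by simp
  qed
  then have "card (UNIV - {0 :: 'a}) \<le> card (\<Union>w\<in>?R. {x. x ^ b = w})"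
    by (intro card_mono) auto
  also have "\<dots> \<le> (\<Sum>w\<in>?R. card {x. x ^ b = w})"
    by (intro card_UN_le) auto
  \<comment> \<open>The index set contains \<open>y\<close>, whose fibre is too small; this makes
    the sum strictly smaller.\<close>
  also have "\<dots> < (\<Sum>w\<in>?R. b)"
    using less y card_power_eq_le[OF pos(2)] by (intro sum_strict_mono_ex1) auto
  also have "\<dots> \<le> a * b"
    using card_power_eq_le[OF pos(1), of "1 :: 'a"] by simp
  finally show False
    using card by (simp add: card_Diff_singleton)
qed

lemma ex_power_eq:
  fixes y :: "'a::{field,finite}"
  assumes "card (UNIV :: 'a set) = a * b + 1" "a > 0" "b > 0" "y ^ a = 1"
  obtains x where "x ^ b = y"
proof -
  have "{x. x ^ b = y} \<noteq> {}" using card_power_eq[OF assms] assms(3) by (metis card.empty less_irrefl)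
  with that show ?thesis by blast
qed

text \<open>The characteristic of a finite field is a prime dividing its order.\<close>

lemma CHAR_eq_of_card:
  assumes "prime p" and "card (UNIV :: 'a::{field,finite} set) = p ^ n"
  shows "CHAR('a) = p"
proof -
  have prime: "prime CHAR('a)"
    by (simp add: prime_CHAR_semidom finite_imp_CHAR_pos)
  moreover have "CHAR('a) dvd p ^ n" using CHAR_dvd_CARD[where 'a = 'a] assms(2) by simp
  ultimately show ?thesis using assms(1) by (metis prime_dvd_power primes_dvd_imp_eq)
qed

lemma card_fibres:
  assumes "finite A" "f ` A \<subseteq> R" "finite R" "\<And>r. r \<in> R \<Longrightarrow> card {x \<in> A. f x = r} = n"
  shows "card A = card R * n"
proof -
  have "card A = (\<Sum>r\<in>R. card {x \<in> A. f x = r})"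
    using sum.group[OF assms(1,3,2), of "\<lambda>_. 1::nat"] by simp
  then show ?thesis using assms(4) by simp
qed

section \<open>The case \<open>q \<ge> 8\<close>\<close>

lemma curve_ge_8:
  assumes "primepow q" and "q \<ge> 8" and card: "card (UNIV :: 'a::{field,finite} set) = q ^ 2"
  shows "\<exists>C :: 'a poly3. plane_curve 3 C \<and> absolutely_irreducible C \<and>
           card (rational_points C \<inter> rational_points (hermitian_form q)) = 3 * (q + 1)"
proof -
  obtain p k where p: "prime p" "q = p ^ k"
    using assms(1) by (auto simp: primepow_def)
  then have "CHAR('a) = p"
    using card by (intro CHAR_eq_of_card[where n = "k * 2"]) (simp_all add: power_mult)
  with p have prime: "prime CHAR('a)" and q: "q = CHAR('a) ^ k" by simp_all
  \<comment> \<open>Additivity of the \<open>q\<close>-th power makes its fixed points the subfield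
    with \<open>q\<close> elements; all parameters below are shown to be fixed by it.\<close>
  have add: "(x + y) ^ q = x ^ q + y ^ q" for x y :: 'a
    using freshmans_dream'[OF prime q] .
  \<comment> \<open>The first factorisation serves the exponent \<open>q - 1\<close>, counting units
    of the subfield; the second serves the norm exponent \<open>q + 1\<close>.\<close>
  have q_sq: "card (UNIV :: 'a set) = (q + 1) * (q - 1) + 1"
    "card (UNIV :: 'a set) = (q - 1) * (q + 1) + 1"
    using assms(2) card by (cases q; simp add: power2_eq_square)+
  have neg: "(- x) ^ q = - (x ^ q)" for x :: 'a
    using add[of x "- x"] assms(2) by (simp add: power_0_left eq_neg_iff_add_eq_0 add.commute)

  \<comment> \<open>The roots of \<open>f\<close> are the degenerate parameters: at 0 and -1 a
    denominator vanishes, the factors \<open>s - 1\<close>, \<open>2 + s\<close> and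
    \<open>2 * s + 1\<close> correspond to coinciding norms, and \<open>1 + s + s ^ 2\<close> to
    vanishing norms. In characteristic two \<open>2 * s + 1\<close> is constant, so only a bound on
    the degree is available.\<close>
  define f :: "'a poly" where
    "f = [:0, 1:] * [:1, 1:] * [:- 1, 1:] * [:2, 1:] * [:1, 2:] * [:1, 1, 1:]"
  have f0: "f \<noteq> 0" by (simp add: f_def del: mult_pCons_left mult_pCons_right)
  have "degree f \<le> 7" by (simp add: f_def degree_pCons_eq_if)
  then have "card {x. poly f x = 0} \<le> 7" using card_poly_roots_bound[OF f0] by simp
  moreover have "card {x :: 'a. x ^ (q - 1) = 1} = q - 1"
    using card_power_eq[OF q_sq(1), of 1] assms(2) by simp
  moreover have "0 \<notin> {x :: 'a. x ^ (q - 1) = 1}" using assms(2) by (simp add: power_0_left)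
  \<comment> \<open>The subfield has at least eight elements and \<open>f\<close> at most seven
    roots.\<close>
  ultimately have "card {x. poly f x = 0} < card (insert 0 {x :: 'a. x ^ (q - 1) = 1})"
    using assms(2) by simp
  then have "\<not> insert 0 {x :: 'a. x ^ (q - 1) = 1} \<subseteq> {x. poly f x = 0}"
    using card_mono[OF poly_roots_finite[OF f0]] by (meson leD)
  then obtain s where s: "s = 0 \<or> s ^ (q - 1) = 1" "poly f s \<noteq> 0" by blast
  have "poly f s = s * (1 + s) * (s - 1) * (2 + s) * (2 * s + 1) * (1 + s + s ^ 2)"
    by (simp add: f_def algebra_simps power2_eq_square)
  with s(2) have s_ne: "s \<noteq> 0" "1 + s \<noteq> 0" "s \<noteq> 1" "2 + s \<noteq> 0" "2 * s + 1 \<noteq> 0"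
      and w_ne: "1 + s + s ^ 2 \<noteq> 0"
    by auto
  have "s ^ q = s * s ^ (q - 1)" using assms(2) by (metis power_eq_if not_numeral_le_zero)
  then have s_q: "s ^ q = s" using s(1) s_ne(1) by simp

  \<comment> \<open>The reciprocals of \<open>n1, n2, n3\<close> are
    \<open>1, s, - s / (1 + s)\<close> times \<open>- (1 + s) / w\<close>. This factor makes the sum
    of the reciprocals -1, so that the linear and constant coefficients of the trinomial agree;
    \<open>b\<close> is the product of the three norms.\<close>
  define w where "w = 1 + s + s ^ 2"
  define b where "b = w ^ 3 / (s ^ 2 * (1 + s) ^ 2)"
  define n1 n2 n3 where "n1 = - w / (1 + s)" and "n2 = - w / (s * (1 + s))" and "n3 = w / s"
  have w0: "w \<noteq> 0" using w_ne by (simp add: w_def)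
  have b0: "b \<noteq> 0" using w0 s_ne by (simp add: b_def)
  have n0: "n1 \<noteq> 0" "n2 \<noteq> 0" "n3 \<noteq> 0" using w0 s_ne by (simp_all add: n1_def n2_def n3_def)
  have w_q: "w ^ q = w"
    by (simp add: w_def add s_q power_mult[symmetric] mult.commute[of 2]) (simp add: power_mult s_q)
  have b_q: "b ^ q = b"
    by (simp add: b_def power_divide power_mult_distrib add s_q w_q
          flip: power_mult) (simp add: mult.commute[of _ q] power_mult add s_q w_q)
  have n_q: "n1 ^ q = n1" "n2 ^ q = n2" "n3 ^ q = n3"
    by (simp_all add: n1_def n2_def n3_def power_divide power_mult_distrib add neg s_q w_q)
  have fixed: "x ^ (q - 1) = 1" if "x ^ q = x" "x \<noteq> 0" for x :: 'a
  proof -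
    have "x * x ^ (q - 1) = x" using assms(2) that(1) by (metis power_eq_if not_numeral_le_zero)
    then show ?thesis using that(2) by simp
  qed
  have dist: "n1 \<noteq> n2" "n1 \<noteq> n3" "n2 \<noteq> n3"
  proof -
    have "n1 = n2 * s" using s_ne by (simp add: n1_def n2_def)
    then show "n1 \<noteq> n2" using s_ne n0 by auto
    show "n1 \<noteq> n3"
    proof
      assume "n1 = n3"
      then have "w * (2 * s + 1) = 0" using s_ne by (simp add: n1_def n3_def field_simps)
      then show False using w0 s_ne by simp
    qed
    show "n2 \<noteq> n3"
    proof
      assume "n2 = n3"
      moreover have "n2 * (1 + s) = - n3" using s_ne by (simp add: n2_def n3_def)
      ultimately have "n3 * (2 + s) = 0" by (simp add: algebra_simps)
      then show False using n0 s_ne by simp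
    qed
  qed
  have "n1 + n2 + n3 = 0"
    using s_ne by (simp add: n1_def n2_def n3_def divide_simps) (simp add: algebra_simps)
  then have n3: "n3 = - n1 - n2" by (simp add: algebra_simps add_eq_0_iff)
  \<comment> \<open>Because the three norms sum to zero, \<open>n1 * n3 + n2 * n3\<close> equals
    \<open>- n3 ^ 2\<close>.\<close>
  have "n1 * n2 + n1 * n3 + n2 * n3 = n1 * n2 - n3 ^ 2"
    unfolding n3 by (simp add: algebra_simps power2_eq_square)
  also have "\<dots> = w ^ 2 * (s - (1 + s) ^ 2) / (s ^ 2 * (1 + s) ^ 2)"
    using s_ne by (simp add: n1_def n2_def n3_def divide_simps power2_eq_square)
      (simp add: algebra_simps)
  also have "s - (1 + s) ^ 2 = - w"
    by (simp add: w_def algebra_simps power2_eq_square)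
  finally have e2: "n1 * n2 + n1 * n3 + n2 * n3 = - b"
    by (simp add: b_def power2_eq_square power3_eq_cube)
  have e3: "n1 * n2 * n3 = b"
    using s_ne by (simp add: n1_def n2_def n3_def b_def power2_eq_square power3_eq_cube ac_simps)
  have roots: "n + - 1 / b * n ^ 3 + 1 = 0 \<longleftrightarrow> n \<in> {n1, n2, n3}" for n
  proof -
    have "(n - n1) * (n - n2) * (n - n3) =
        n ^ 3 - (n1 + n2 + n3) * n ^ 2 + (n1 * n2 + n1 * n3 + n2 * n3) * n - n1 * n2 * n3"
      by (simp add: algebra_simps power2_eq_square power3_eq_cube)
    also have "\<dots> = n ^ 3 - b * n - b"
      unfolding e2 e3 \<open>n1 + n2 + n3 = 0\<close> by simp
    also have "\<dots> = - b * (n + - 1 / b * n ^ 3 + 1)"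
      using b0 by (simp add: algebra_simps)
    finally have "(n - n1) * (n - n2) * (n - n3) = - b * (n + - 1 / b * n ^ 3 + 1)" .
    then show ?thesis using b0 by (metis eq_iff_diff_eq_0 insert_iff mult_eq_0_iff neg_equal_0_iff_equal singletonD)
  qed
  \<comment> \<open>A nonzero element of the subfield is a norm, which supplies the coefficient
    \<open>a\<close> of the cubic.\<close>
  have "(- 1 / b) ^ (q - 1) = 1"
    using b0 b_q by (intro fixed) (simp_all add: power_divide neg)
  then obtain a where a: "a ^ (q + 1) = - 1 / b"
    using ex_power_eq[OF q_sq(2), of "- 1 / b"] assms(2) by auto
  have a0: "a \<noteq> 0" using a b0 by (metis add_eq_0_iff_both_eq_0 divide_eq_0_iff neg_equal_0_iff_equal power_0_left zero_neq_one)

  let ?C = "cubic 0 0 (- a) 0 0 0 :: 'a poly3"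
  let ?X = "{x. x ^ (q + 1) \<in> {n1, n2, n3}}"
  have "card (rational_points ?C \<inter> rational_points (hermitian_form q)) =
      card {(x, y, z). (\<lambda>(x, y, z). z) (x, y, z) = 1 \<and> eval3 ?C (x, y, z) = 0 \<and>
        x ^ (q + 1) + y ^ (q + 1) + z ^ (q + 1) = 0}"
    by (rule card_cubic_hermitian) (use a0 in auto)
  also have "{(x, y, z). (\<lambda>(x, y, z). z) (x, y, z) = 1 \<and> eval3 ?C (x, y, z) = 0 \<and>
        x ^ (q + 1) + y ^ (q + 1) + z ^ (q + 1) = 0} = (\<lambda>x. (x, a * x ^ 3, 1)) ` ?X"
  proof -
    \<comment> \<open>After \<open>y = a * x ^ 3\<close> is substituted, the Hermitian equation
      depends on \<open>x\<close> only through its norm.\<close>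
    have "x ^ (q + 1) + (a * x ^ 3) ^ (q + 1) + 1 ^ (q + 1) = 0 \<longleftrightarrow> x ^ (q + 1) \<in> {n1, n2, n3}" for x
    proof -
      have "(a * x ^ 3) ^ (q + 1) = - 1 / b * (x ^ (q + 1)) ^ 3"
        unfolding power_mult_distrib a by (simp only: mult.commute flip: power_mult)
      with roots[of "x ^ (q + 1)"] show ?thesis by (simp only: power_one)
    qed
    then show ?thesis by (auto simp del: power_Suc power_add simp: image_iff)
  qed
  also have "card \<dots> = card ?X"
    by (rule card_image) (auto simp: inj_on_def)
  also have "card ?X = card {n1, n2, n3} * (q + 1)"
  proof (rule card_fibres)
    show "card {x \<in> ?X. x ^ (q + 1) = r} = q + 1" if "r \<in> {n1, n2, n3}" for r
    proof -
      have "{x \<in> ?X. x ^ (q + 1) = r} = {x. x ^ (q + 1) = r}" using that by auto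
      moreover have "r ^ (q - 1) = 1" using that n0 n_q fixed by auto
      ultimately show ?thesis using card_power_eq[OF q_sq(2), of r] assms(2) by simp
    qed
  qed auto
  also have "card {n1, n2, n3} = 3" using dist by simp
  finally have "card (rational_points ?C \<inter> rational_points (hermitian_form q)) = 3 * (q + 1)" .
  moreover have "absolutely_irreducible ?C" using a0 by (intro absolutely_irreducible_cubic) simp
  ultimately show ?thesis using plane_curve_cubic by blast
qed

section \<open>Computing in finite fields given by generators\<close>

text \<open>Integer coefficient lists stand for field elements because \<open>code_simp\<close> can
  compute with them, whereas the field is an abstract type.\<close>

definition horner_int :: "'a::comm_ring_1 \<Rightarrow> int list \<Rightarrow> 'a" where
  "horner_int g xs = foldr (\<lambda>a y. of_int a + g * y) xs 0"

fun add_list :: "int list \<Rightarrow> int list \<Rightarrow> int list" where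
  "add_list [] ys = ys"
| "add_list xs [] = xs"
| "add_list (x # xs) (y # ys) = (x + y) # add_list xs ys"

fun mult_list :: "int list \<Rightarrow> int list \<Rightarrow> int list" where
  "mult_list [] ys = []"
| "mult_list (x # xs) ys = add_list (map ((*) x) ys) (0 # mult_list xs ys)"

text \<open>Reduction of the polynomial with coefficient list \<open>xs\<close> modulo \<open>p\<close> and the
  relation \<open>g ^ length r = horner_int g r\<close>.\<close>

fun reduce_list :: "int \<Rightarrow> int list \<Rightarrow> int list \<Rightarrow> int list" where
  "reduce_list p r [] = map (\<lambda>_. 0) r"
| "reduce_list p r (x # xs) =
     (let ys = reduce_list p r xs
      in map2 (\<lambda>u v. (u + last ys * v) mod p) (x # butlast ys) r)"

text \<open>Reducing after every factor keeps the lists short and their entries small.\<close>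

fun power_list :: "int \<Rightarrow> int list \<Rightarrow> int list \<Rightarrow> nat \<Rightarrow> int list" where
  "power_list p r xs 0 = [1]"
| "power_list p r xs (Suc n) = reduce_list p r (mult_list xs (power_list p r xs n))"

lemma horner_int_Nil [simp]: "horner_int g [] = 0"
  and horner_int_Cons [simp]: "horner_int g (x # xs) = of_int x + g * horner_int g xs"
  by (simp_all add: horner_int_def)

lemma horner_int_add: "horner_int g (add_list xs ys) = horner_int g xs + horner_int g ys"
  by (induction xs ys rule: add_list.induct) (simp_all add: algebra_simps)

lemma horner_int_scale: "horner_int g (map ((*) c) xs) = of_int c * horner_int g xs"
  by (induction xs) (simp_all add: algebra_simps)

lemma horner_int_mult: "horner_int g (mult_list xs ys) = horner_int g xs * horner_int g ys"
  by (induction xs) (simp_all add: horner_int_add horner_int_scale algebra_simps)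

lemma horner_int_append:
  "horner_int g (xs @ ys) = horner_int g xs + g ^ length xs * horner_int g ys"
  by (induction xs) (simp_all add: algebra_simps)

lemma horner_int_map2:
  assumes "length xs = length ys" and "\<And>n. of_int (n mod p) = (of_int n :: 'a::comm_ring_1)"
  shows "horner_int (g :: 'a) (map2 (\<lambda>u v. (u + c * v) mod p) xs ys) =
     horner_int g xs + of_int c * horner_int g ys"
  using assms(1) by (induction xs ys rule: list_induct2) (simp_all add: assms(2) algebra_simps)

section \<open>Transfer between list computations and the field\<close>

locale residue_lists =
  fixes p :: int and r :: "int list" and g :: "'a::field"
  assumes p0: "of_int p = (0 :: 'a)"
    and r_ne: "r \<noteq> []"
    and g: "g ^ length r = horner_int g r"
begin

lemma of_int_mod: "of_int (n mod p) = (of_int n :: 'a)"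
proof -
  have "of_int n = of_int (n div p) * of_int p + (of_int (n mod p) :: 'a)"
    by (simp flip: of_int_mult of_int_add)
  then show ?thesis using p0 by simp
qed

lemma length_reduce [simp]: "length (reduce_list p r xs) = length r"
  using r_ne by (induction xs) (simp_all add: Let_def)

lemma horner_int_zero [simp]: "horner_int g (map (\<lambda>_. 0) xs) = 0"
  by (induction xs) auto

text \<open>In the induction step the value of \<open>ys\<close> is multiplied by \<open>g\<close>.
  Its last entry moves to \<open>g ^ length r\<close>, which is rewritten as
  \<open>horner_int g r\<close>.\<close>

lemma horner_int_reduce: "horner_int g (reduce_list p r xs) = horner_int g xs"
proof (induction xs)
  case (Cons x xs)
  define ys where "ys = reduce_list p r xs"
  have len: "length ys = length r" by (simp add: ys_def)
  with r_ne have ys: "length ys = length r" "ys \<noteq> []" by auto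
  have len': "length (x # butlast ys) = length r" using ys by (cases ys rule: rev_cases) auto
  then have g': "horner_int g r = g * g ^ length (butlast ys)" by (metis g length_Cons power_Suc)
  have "reduce_list p r (x # xs) = map2 (\<lambda>u v. (u + last ys * v) mod p) (x # butlast ys) r"
    by (simp add: Let_def ys_def)
  then have "horner_int g (reduce_list p r (x # xs)) =
      of_int x + (g * horner_int g (butlast ys) + of_int (last ys) * horner_int g r)"
    using horner_int_map2[OF len' of_int_mod] by simp
  also have "g * horner_int g (butlast ys) + of_int (last ys) * horner_int g r
      = g * horner_int g (butlast ys @ [last ys])"
    unfolding g' by (simp add: horner_int_append algebra_simps)
  also have "butlast ys @ [last ys] = ys" using ys by simp
  finally show ?case using Cons by (simp add: ys_def)
qed simp

lemma horner_int_power: "horner_int g (power_list p r xs n) = horner_int g xs ^ n"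
  by (induction n) (simp_all add: horner_int_reduce horner_int_mult)

lemma horner_int_eq_0: "reduce_list p r xs = map (\<lambda>_. 0) r \<Longrightarrow> horner_int g xs = 0"
  by (metis horner_int_reduce horner_int_zero)

end

text \<open>Invertibility of all nonzero residues makes the zero test complete.\<close>

locale residue_field_lists = residue_lists p r g
  for p :: int and r and g :: "'a::{field,finite}" +
  fixes V :: "int list list"
  assumes p_pos: "p > 0"
    and V: "V = product_lists (map (\<lambda>_. [0..p - 1]) r)" "distinct V" "card (UNIV :: 'a set) = length V"
    and inverse: "\<forall>v\<in>set V. v = map (\<lambda>_. 0) r \<or>
          (\<exists>w\<in>set V. reduce_list p r (mult_list v w) = reduce_list p r [1])"
    and separated: "\<forall>v\<in>set V. \<forall>w\<in>set V. v = w \<or>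
          reduce_list p r (add_list v (map ((*) (- 1)) w)) \<noteq> map (\<lambda>_. 0) r"
begin

lemma closed: "reduce_list p r xs \<in> set V"
proof -
  have "set (reduce_list p r xs) \<subseteq> {0..p - 1}"
    using p_pos by (cases xs) (auto simp: Let_def simp del: butlast.simps)
  then show ?thesis
    unfolding V(1) product_lists_set by (auto simp: list_all2_conv_all_nth subset_iff)
qed

lemma horner_int_eq_0_iff:
  "horner_int g xs = 0 \<longleftrightarrow> reduce_list p r xs = map (\<lambda>_. 0) r"
proof
  assume 0: "horner_int g xs = 0"
  show "reduce_list p r xs = map (\<lambda>_. 0) r"
  proof (rule ccontr)
    assume "reduce_list p r xs \<noteq> map (\<lambda>_. 0) r"
    then obtain w where "reduce_list p r (mult_list (reduce_list p r xs) w) = reduce_list p r [1]"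
      using inverse closed by blast
    then have "horner_int g (mult_list (reduce_list p r xs) w) = horner_int g [1]"
      by (metis horner_int_reduce)
    then show False using 0 by (simp add: horner_int_mult horner_int_reduce)
  qed
qed (rule horner_int_eq_0)

text \<open>By \<open>separated\<close> the difference of two distinct lists has a nonzero
  reduction, so the complete zero test tells their values apart. Counting then turns injectivity
  into surjectivity.\<close>

lemma inj_horner_int: "inj_on (horner_int g) (set V)"
proof (rule inj_onI, rule ccontr)
  fix v w assume "v \<in> set V" "w \<in> set V" "horner_int g v = horner_int g w" "v \<noteq> w"
  moreover from this(3) have "horner_int g (add_list v (map ((*) (- 1)) w)) = 0"
    unfolding horner_int_add horner_int_scale by simp
  ultimately show False using separated horner_int_eq_0_iff by blast
qed

lemma horner_int_surj: "horner_int g ` set V = UNIV"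
  by (rule card_subset_eq) (simp_all add: card_image[OF inj_horner_int] V(3) distinct_card[OF V(2)])

text \<open>Replaces the count of affine points by a finite enumeration that
  \<open>code_simp\<close> can evaluate.\<close>

lemma card_pairs:
  assumes "\<And>v w. v \<in> set V \<Longrightarrow> w \<in> set V \<Longrightarrow> P (horner_int g v) (horner_int g w) \<longleftrightarrow> Q v w"
  shows "card {(x, y). P x y} = length (filter (\<lambda>(v, w). Q v w) (List.product V V))"
proof -
  let ?h = "map_prod (horner_int g) (horner_int g)"
  let ?F = "filter (\<lambda>(v, w). Q v w) (List.product V V)"
  have "{(x, y). P x y} = ?h ` set ?F"
  proof (intro equalityI subsetI)
    fix s assume "s \<in> {(x, y). P x y}"
    moreover obtain v w where "s = (horner_int g v, horner_int g w)" "v \<in> set V" "w \<in> set V"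
      using horner_int_surj by (metis (no_types, opaque_lifting) UNIV_I imageE surj_pair)
    ultimately show "s \<in> ?h ` set ?F" using assms by force
  qed (use assms in auto)
  moreover have "inj_on ?h (set ?F)"
    using inj_on_subset[OF map_prod_inj_on[OF inj_horner_int inj_horner_int]] by fastforce
  ultimately have "card {(x, y). P x y} = card (set ?F)" by (simp only: card_image)
  also have "\<dots> = length ?F"
    using V(2) by (intro distinct_card distinct_filter distinct_product)
  finally show ?thesis .
qed

end

section \<open>The cases \<open>q = 3, 4, 5, 7\<close>\<close>

text \<open>On the chart \<open>y = 1\<close> the cubic is \<open>z ^ 2 = 1 - x ^ 3\<close>. With
  \<open>s = x ^ 3\<close> the Hermitian equation becomes a cubic in \<open>s\<close> with roots -1
  and the two square roots of 2, and every root yields three \<open>x\<close> and two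
  \<open>z\<close>.\<close>

lemma curve_5:
  assumes card: "card (UNIV :: 'a::{field,finite} set) = 5 ^ 2"
  shows "\<exists>C :: 'a poly3. plane_curve 3 C \<and> absolutely_irreducible C \<and>
           card (rational_points C \<inter> rational_points (hermitian_form 5)) = 3 * (5 + 1)"
proof -
  have "CHAR('a) = 5" using card by (intro CHAR_eq_of_card[where n = 2]) simp_all
  then have five: "(5 :: 'a) = 0" using of_nat_CHAR[where 'a = 'a] by simp
  have two: "(2 :: 'a) \<noteq> 0"
  proof
    assume "(2 :: 'a) = 0"
    moreover have "(1 :: 'a) = 5 - 2 * 2" by simp
    ultimately show False using five by simp
  qed
  have "(2 :: 'a) ^ 4 = 1 + 5 * 3" by simp
  then have two4: "(2 :: 'a) ^ 4 = 1" using five by simp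
  then have two12: "(2 :: 'a) ^ 12 = 1" using power_mult[of "2 :: 'a" 4 3] by simp
  then obtain r :: 'a where r: "r ^ 2 = 2"
    using ex_power_eq[of 12 2 "2 :: 'a"] card by auto
  \<comment> \<open>Needed to see that \<open>1 - s\<close> is a square: its twelfth power is then
    \<open>2 ^ 4 = 1\<close>.\<close>
  have cube: "(1 - s) ^ 3 = 2" if "s ^ 2 = 2" for s :: 'a
  proof -
    have "(1 - s) ^ 3 = 2 + 5 * (1 - s) + (3 - s) * (s ^ 2 - 2)"
      by (simp add: algebra_simps power2_eq_square power3_eq_cube)
    then show ?thesis using five that by simp
  qed
  let ?R = "{- 1, r, - r}"
  let ?A = "{(x :: 'a, z). z ^ 2 = 1 - x ^ 3 \<and> x ^ 3 \<in> ?R}"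
  have iff: "z ^ 2 + x ^ 3 - 1 = 0 \<and> x ^ 6 + 1 + z ^ 6 = 0 \<longleftrightarrow>
      z ^ 2 = 1 - x ^ 3 \<and> x ^ 3 \<in> ?R" for x z :: 'a
  proof (cases "z ^ 2 = 1 - x ^ 3")
    case True
    define s where "s = x ^ 3"
    have "x ^ 6 = s ^ 2" "z ^ 6 = (1 - s) ^ 3"
      using power_mult[of x 3 2] power_mult[of z 2 3] True by (simp_all add: s_def)
    then have "x ^ 6 + 1 + z ^ 6 = - (s + 1) * (s ^ 2 - 2) + 5 * (s ^ 2 - s)"
      by (simp add: algebra_simps power2_eq_square power3_eq_cube)
    also have "\<dots> = - ((s + 1) * (s - r) * (s + r))"
      using five r by (simp add: algebra_simps power2_eq_square)
    finally have eq: "x ^ 6 + 1 + z ^ 6 = - ((s + 1) * (s - r) * (s + r))" .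
    have "x ^ 6 + 1 + z ^ 6 = 0 \<longleftrightarrow> x ^ 3 \<in> ?R"
      unfolding eq by (simp add: s_def eq_neg_iff_add_eq_0)
    then show ?thesis using True by simp
  qed (auto simp: algebra_simps)
  have dist: "card ?R = 3"
  proof -
    have "r \<noteq> 0" using r two by auto
    then have "r \<noteq> - r" using two by (metis add_eq_0_iff mult_2 mult_eq_0_iff)
    moreover have "(1 :: 'a) \<noteq> 2" by (metis add_cancel_right_right one_add_one zero_neq_one)
    then have "- 1 \<noteq> r" "- 1 \<noteq> - r" using r by auto
    ultimately show ?thesis by simp
  qed
  have "card ?A = card ?R * 6"
  proof (rule card_fibres[where f = "\<lambda>(x, z). x ^ 3"])
    fix s assume s: "s \<in> ?R"
    have "s ^ 8 = 1"
      using s r power_mult[of r 2 4] two4 by auto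
    then have "card {x. x ^ 3 = s} = 3"
      using card_power_eq[of 8 3 s] card by simp
    moreover have "(1 - s) ^ 12 = 1"
    proof (cases "s = - 1")
      case True
      then show ?thesis using two12 by simp
    next
      case False
      then have "s ^ 2 = 2" using s r by auto
      have "(1 - s) ^ 12 = ((1 - s) ^ 3) ^ 4" by (simp flip: power_mult)
      also have "\<dots> = 1" unfolding cube[OF \<open>s ^ 2 = 2\<close>] two4 ..
      finally show ?thesis .
    qed
    then have "card {z. z ^ 2 = 1 - s} = 2"
      using card_power_eq[of 12 2 "1 - s"] card by simp
    moreover have "{v \<in> ?A. (case v of (x, z) \<Rightarrow> x ^ 3) = s} = {x. x ^ 3 = s} \<times> {z. z ^ 2 = 1 - s}"
      using s by auto
    ultimately show "card {v \<in> ?A. (case v of (x, z) \<Rightarrow> x ^ 3) = s} = 6"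
      by (simp add: card_cartesian_product)
  qed auto
  then have "card (rational_points (cubic 0 0 1 0 0 (- 1 :: 'a)) \<inter> rational_points (hermitian_form 5)) = 18"
    using iff dist by (simp add: card_cubic_hermitian_affine)
  moreover have "absolutely_irreducible (cubic 0 0 1 0 0 (- 1 :: 'a))"
    by (intro absolutely_irreducible_cubic) simp
  ultimately show ?thesis
    using plane_curve_cubic by (intro exI[of _ "cubic 0 0 1 0 0 (- 1)"]) simp
qed

text \<open>On the chart \<open>y = 1\<close> the cubic is \<open>z ^ 2 = - x * (x ^ 2 + 3)\<close>.
  With \<open>u = x ^ 2\<close> the Hermitian equation is a sextic in \<open>u\<close> with six
  roots in the field, each giving two \<open>x\<close> and two \<open>z\<close> for each of
  them.\<close>

lemma curve_7:
  assumes card: "card (UNIV :: 'a::{field,finite} set) = 7 ^ 2"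
  shows "\<exists>C :: 'a poly3. plane_curve 3 C \<and> absolutely_irreducible C \<and>
           card (rational_points C \<inter> rational_points (hermitian_form 7)) = 3 * (7 + 1)"
proof -
  have "CHAR('a) = 7" using card by (intro CHAR_eq_of_card[where n = 2]) simp_all
  then have seven: "(7 :: 'a) = 0" using of_nat_CHAR[where 'a = 'a] by simp
  obtain i :: 'a where i: "i ^ 2 = - 1"
    using ex_power_eq[of 24 2 "- 1 :: 'a"] card by auto
  interpret residue_lists 7 "[- 1, 0]" i
    by standard (use seven i in \<open>simp_all add: power2_eq_square\<close>)
  define f :: "'a poly" where "f = [:1, 0, 81, 108, 55, 12, 1:]"
  have f: "poly f u = u ^ 4 + 1 + u ^ 2 * (u + 3) ^ 4" for u
    by (simp add: f_def algebra_simps power2_eq_square power4_eq_xxxx)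
  \<comment> \<open>The six roots of \<open>f\<close>, written as \<open>a + b * i\<close>.\<close>
  define U where "U = [[3, 0], [5, 0], [3, 3], [3, 4], [1, 1], [1, 6 :: int]]"
  let ?R = "horner_int i ` set U"
  \<comment> \<open>A difference whose 48th power is 1 cannot be zero.\<close>
  have "\<forall>u\<in>set U. \<forall>v\<in>set U. u = v \<or>
      power_list 7 [- 1, 0] (add_list u (map ((*) (- 1)) v)) 48 = [1, 0]"
    unfolding U_def by code_simp
  have "inj_on (horner_int i) (set U)"
  proof (rule inj_onI, rule ccontr)
    fix u v assume uv: "u \<in> set U" "v \<in> set U" "horner_int i u = horner_int i v" "u \<noteq> v"
    then have "horner_int i (add_list u (map ((*) (- 1)) v)) ^ 48 = horner_int i [1, 0]"
      using \<open>\<forall>u\<in>set U. _\<close> by (metis horner_int_power)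
    moreover from uv(3) have "horner_int i (add_list u (map ((*) (- 1)) v)) = 0"
      unfolding horner_int_add horner_int_scale by simp
    ultimately show False by simp
  qed
  then have card_R: "card ?R = 6"
    by (simp add: card_image U_def)
  have "?R \<subseteq> {u. poly f u = 0}"
  proof clarify
    fix u assume u: "u \<in> set U"
    let ?F = "\<lambda>u. add_list (power_list 7 [- 1, 0] u 4) (add_list [1]
      (mult_list (power_list 7 [- 1, 0] u 2) (power_list 7 [- 1, 0] (add_list u [3]) 4)))"
    have "\<forall>u\<in>set U. reduce_list 7 [- 1, 0] (?F u) = map (\<lambda>_. 0) [- 1, 0 :: int]"
      unfolding U_def by code_simp
    then have "horner_int i (?F u) = 0" using u horner_int_eq_0 by blast
    then show "poly f (horner_int i u) = 0"
      by (simp add: f horner_int_add horner_int_mult horner_int_power add.assoc)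
  qed
  moreover have "f \<noteq> 0" "degree f = 6" by (simp_all add: f_def)
  ultimately have R: "?R = {u. poly f u = 0}"
    using card_poly_roots_bound[of f] poly_roots_finite[of f] card_R
    by (intro card_seteq) auto
  \<comment> \<open>Euler's criterion for \<open>u\<close> and for \<open>- x * (u + 3)\<close>. The
    24th power of the latter depends on \<open>u = x ^ 2\<close> alone.\<close>
  have unit: "u ^ 24 = 1" "u ^ 12 * (u + 3) ^ 24 = 1" if u: "u \<in> ?R" for u
  proof -
    obtain v where v: "v \<in> set U" "u = horner_int i v" using u by blast
    have "\<forall>v\<in>set U. power_list 7 [- 1, 0] v 24 = [1, 0] \<and>
      reduce_list 7 [- 1, 0] (mult_list (power_list 7 [- 1, 0] v 12)
        (power_list 7 [- 1, 0] (add_list v [3]) 24)) = [1, 0]"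
      unfolding U_def by code_simp
    then have "horner_int i (power_list 7 [- 1, 0] v 24) = 1"
      "horner_int i (reduce_list 7 [- 1, 0] (mult_list (power_list 7 [- 1, 0] v 12)
        (power_list 7 [- 1, 0] (add_list v [3]) 24))) = 1"
      using v by auto
    then show "u ^ 24 = 1" "u ^ 12 * (u + 3) ^ 24 = 1"
      using v by (simp_all add: horner_int_reduce horner_int_mult horner_int_power horner_int_add)
  qed
  let ?A = "{(x :: 'a, z). z ^ 2 = - x * (x ^ 2 + 3) \<and> x ^ 2 \<in> ?R}"
  have iff: "z ^ 2 + x ^ 3 + 3 * x = 0 \<and> x ^ 8 + 1 + z ^ 8 = 0 \<longleftrightarrow>
      z ^ 2 = - x * (x ^ 2 + 3) \<and> x ^ 2 \<in> ?R" for x z :: 'a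
  proof -
    have eq: "z ^ 2 + x ^ 3 + 3 * x = z ^ 2 - - x * (x ^ 2 + 3)"
      by (simp add: algebra_simps power2_eq_square power3_eq_cube)
    have "x ^ 8 + 1 + z ^ 8 = poly f (x ^ 2)" if "z ^ 2 = - x * (x ^ 2 + 3)"
    proof -
      have "x ^ 8 = (x ^ 2) ^ 4" by (simp flip: power_mult)
      moreover have "z ^ 8 = (x ^ 2) ^ 2 * (x ^ 2 + 3) ^ 4"
        using power_mult[of z 2 4] that by (simp add: power_mult_distrib flip: power_mult)
      ultimately show ?thesis by (simp add: f)
    qed
    then show ?thesis unfolding R eq right_minus_eq by auto
  qed
  have "card ?A = card ?R * 4"
  proof (rule card_fibres[where f = "\<lambda>(x, z). x ^ 2"])
    fix u assume u: "u \<in> ?R"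
    have "card {x. x ^ 2 = u} = 2"
      using card_power_eq[of 24 2 u] card unit(1)[OF u] by simp
    moreover have "card {z. z ^ 2 = - x * (u + 3)} = 2" if "x ^ 2 = u" for x
    proof -
      have "(- x * (u + 3)) ^ 24 = u ^ 12 * (u + 3) ^ 24"
        using that power_mult[of x 2 12] by (simp add: power_mult_distrib)
      then show ?thesis
        using card_power_eq[of 24 2 "- x * (u + 3)"] card unit(2)[OF u] by simp
    qed
    moreover have "{v \<in> ?A. (case v of (x, z) \<Rightarrow> x ^ 2) = u} =
        (SIGMA x:{x. x ^ 2 = u}. {z. z ^ 2 = - x * (u + 3)})"
      using u by auto
    ultimately show "card {v \<in> ?A. (case v of (x, z) \<Rightarrow> x ^ 2) = u} = 4"
      by (simp add: card_SigmaI)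
  qed auto
  then have "card (rational_points (cubic 0 0 1 0 (3 :: 'a) 0) \<inter> rational_points (hermitian_form 7)) = 24"
    using iff card_R by (simp add: card_cubic_hermitian_affine)
  moreover have "absolutely_irreducible (cubic 0 0 1 0 (3 :: 'a) 0)"
    by (intro absolutely_irreducible_cubic) simp
  ultimately show ?thesis
    using plane_curve_cubic by (intro exI[of _ "cubic 0 0 1 0 3 0"]) simp
qed

lemma curve_4:
  assumes card: "card (UNIV :: 'a::{field,finite} set) = 4 ^ 2"
  shows "\<exists>C :: 'a poly3. plane_curve 3 C \<and> absolutely_irreducible C \<and>
           card (rational_points C \<inter> rational_points (hermitian_form 4)) = 3 * (4 + 1)"
proof -
  have "CHAR('a) = 2" using card by (intro CHAR_eq_of_card[where n = 4]) simp_all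
  then have two: "(2 :: 'a) = 0" using of_nat_CHAR[where 'a = 'a] by simp
  \<comment> \<open>Modulo 2, \<open>h\<close> is the cofactor of \<open>X ^ 4 + X + 1\<close> in
    \<open>X ^ 15 - 1\<close>. Having degree 11, it misses one of the 15 units, and that unit is a
    root of the quartic.\<close>
  define h :: "'a poly" where "h = [:1, 1, 1, 1, 0, 1, 0, 1, 1, 0, 0, 1:]"
  have h: "h \<noteq> 0" "degree h = 11" by (simp_all add: h_def)
  have "card {x. poly h x = 0} < card (UNIV - {0 :: 'a})"
    using card_poly_roots_bound[OF h(1)] h(2) card by (simp add: card_Diff_singleton)
  then have "\<not> UNIV - {0} \<subseteq> {x. poly h x = 0}"
    using card_mono[OF poly_roots_finite[OF h(1)]] by (meson leD)
  then obtain g :: 'a where g0: "g \<noteq> 0" and hg: "poly h g \<noteq> 0" by blast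
  have "(g ^ 4 + g + 1) * poly h g = g ^ 15 - 1 + 2 * (1 + g + g ^ 2 + g ^ 3 + g ^ 4 + g ^ 5 +
      g ^ 6 + g ^ 7 + g ^ 8 + g ^ 9 + g ^ 11 + g ^ 12)"
    by (simp add: h_def algebra_simps flip: power_Suc power_add) (simp add: eval_nat_numeral algebra_simps)
  also have "\<dots> = 0"
    using two power_card_minus_one[OF g0] card by simp
  finally have "g ^ 4 + g + 1 = 0" using hg by simp
  moreover have "- x = x" for x :: 'a
    using two by (metis add_eq_0_iff mult_2 mult_zero_left)
  ultimately have g: "g ^ 4 = 1 + g" by (metis add.commute add_eq_0_iff group_cancel.add1)
  let ?r = "[1, 1, 0, 0 :: int]" and ?V = "product_lists (map (\<lambda>_. [0..1]) [1, 1, 0, 0 :: int]) :: int list list"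
  interpret residue_field_lists 2 ?r g ?V
  proof
    show "of_int 2 = (0 :: 'a)" using two by simp
    show "g ^ length ?r = horner_int g ?r" using g
      by (simp add: power4_eq_xxxx mult.assoc)
    show "card (UNIV :: 'a set) = length ?V" unfolding card by code_simp
    show "distinct ?V" by code_simp
    show "\<forall>v\<in>set ?V. v = map (\<lambda>_. 0) ?r \<or>
        (\<exists>w\<in>set ?V. reduce_list 2 ?r (mult_list v w) = reduce_list 2 ?r [1])" by code_simp
    show "\<forall>v\<in>set ?V. \<forall>w\<in>set ?V. v = w \<or>
        reduce_list 2 ?r (add_list v (map ((*) (- 1)) w)) \<noteq> map (\<lambda>_. 0) ?r" by code_simp
  qed simp_all
  \<comment> \<open>This is a primitive cube root of unity: \<open>b ^ 2 + b + 1\<close> equals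
    \<open>g ^ 4 + g + 1\<close> in characteristic two.\<close>
  define b where "b = g + g ^ 2"
  have b: "b = horner_int g [0, 1, 1]" by (simp add: b_def algebra_simps power2_eq_square)
  let ?F = "\<lambda>v w. add_list (mult_list w (add_list w v)) (add_list
    (mult_list v (add_list (mult_list v v) (mult_list [0, 1, 1] (add_list v [1])))) [1])"
  let ?G = "\<lambda>v w. add_list (power_list 2 ?r v 5) (add_list [1] (power_list 2 ?r w 5))"
  let ?P = "\<lambda>x z. z ^ 2 + x * z + x ^ 3 + b * x ^ 2 + b * x + 1 = 0 \<and> x ^ 5 + 1 + z ^ 5 = 0"
  let ?Q = "\<lambda>v w. reduce_list 2 ?r (?F v w) = map (\<lambda>_. 0) ?r \<and>
    reduce_list 2 ?r (?G v w) = map (\<lambda>_. 0) ?r"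
  have "card {(x, z). ?P x z} = length (filter (\<lambda>(v, w). ?Q v w) (List.product ?V ?V))"
  proof (rule card_pairs)
    fix v w
    have "horner_int g (?F v w) = horner_int g w ^ 2 + horner_int g v * horner_int g w
        + horner_int g v ^ 3 + b * horner_int g v ^ 2 + b * horner_int g v + 1"
      unfolding horner_int_add horner_int_mult b[symmetric]
      by (simp add: algebra_simps power2_eq_square power3_eq_cube)
    moreover have "horner_int g (?G v w) = horner_int g v ^ 5 + 1 + horner_int g w ^ 5"
      by (simp add: horner_int_add horner_int_power)
    ultimately show "?P (horner_int g v) (horner_int g w) \<longleftrightarrow> ?Q v w"
      by (simp only: flip: horner_int_eq_0_iff)
  qed
  also have "\<dots> = 15" by code_simp
  finally have "card (rational_points (cubic 0 1 1 b b 1) \<inter> rational_points (hermitian_form 4)) = 15"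
    by (simp add: card_cubic_hermitian_affine)
  moreover have "absolutely_irreducible (cubic 0 1 1 b b 1)"
    by (intro absolutely_irreducible_cubic) simp
  ultimately show ?thesis
    using plane_curve_cubic by (intro exI[of _ "cubic 0 1 1 b b 1"]) simp
qed

lemma curve_3:
  assumes card: "card (UNIV :: 'a::{field,finite} set) = 3 ^ 2"
  shows "\<exists>C :: 'a poly3. plane_curve 3 C \<and> absolutely_irreducible C \<and>
           card (rational_points C \<inter> rational_points (hermitian_form 3)) = 3 * (3 + 1)"
proof -
  have "CHAR('a) = 3" using card by (intro CHAR_eq_of_card[where n = 2]) simp_all
  then have three: "(3 :: 'a) = 0" using of_nat_CHAR[where 'a = 'a] by simp
  obtain i :: 'a where i: "i ^ 2 = - 1"
    using ex_power_eq[of 4 2 "- 1 :: 'a"] card by auto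
  then have i2: "i * i = - 1" by (simp add: power2_eq_square)
  let ?r = "[- 1, 0 :: int]" and ?V = "product_lists (map (\<lambda>_. [0..2]) [- 1, 0 :: int]) :: int list list"
  interpret residue_field_lists 3 ?r i ?V
  proof
    show "of_int 3 = (0 :: 'a)" using three by simp
    show "i ^ length ?r = horner_int i ?r" using i2
      by (simp add: power2_eq_square)
    show "card (UNIV :: 'a set) = length ?V" unfolding card by code_simp
    show "distinct ?V" by code_simp
    show "\<forall>v\<in>set ?V. v = map (\<lambda>_. 0) ?r \<or>
        (\<exists>w\<in>set ?V. reduce_list 3 ?r (mult_list v w) = reduce_list 3 ?r [1])" by code_simp
    show "\<forall>v\<in>set ?V. \<forall>w\<in>set ?V. v = w \<or>
        reduce_list 3 ?r (add_list v (map ((*) (- 1)) w)) \<noteq> map (\<lambda>_. 0) ?r" by code_simp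
  qed simp_all
  let ?C = "cubic (i - 1) 0 (1 + i) (- 1 - i) (- i) (- i)"
  let ?c = "\<lambda>x y. (1 + i) * x ^ 3 + (- 1 - i) * x ^ 2 * y + (- i) * x * y ^ 2 + (- i) * y ^ 3"
  \<comment> \<open>The lists \<open>[1, 1]\<close>, \<open>[- 1, - 1]\<close> and
    \<open>[0, - 1]\<close> stand for \<open>1 + i\<close>, \<open>- 1 - i\<close> and
    \<open>- i\<close>.\<close>
  let ?K = "\<lambda>v w. add_list (mult_list [1, 1] (power_list 3 ?r v 3))
    (add_list (mult_list [- 1, - 1] (mult_list (power_list 3 ?r v 2) w))
    (add_list (mult_list [0, - 1] (mult_list v (power_list 3 ?r w 2)))
      (mult_list [0, - 1] (power_list 3 ?r w 3))))"
  have K: "horner_int i (?K v w) = ?c (horner_int i v) (horner_int i w)" for v w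
    unfolding horner_int_add horner_int_mult horner_int_power by (simp add: algebra_simps)
  \<comment> \<open>Excludes common points on the line \<open>z = 0\<close> by checking all 81
    pairs, which justifies the chart \<open>z = 1\<close>.\<close>
  have infinity: "x = 0 \<and> y = 0" if "?c x y = 0" "x ^ 4 + y ^ 4 = 0" for x y
  proof -
    have "x \<in> horner_int i ` set ?V" "y \<in> horner_int i ` set ?V"
      unfolding horner_int_surj by (rule UNIV_I)+
    then obtain v w where v: "v \<in> set ?V" "x = horner_int i v"
      and w: "w \<in> set ?V" "y = horner_int i w" by (elim imageE)
    have "horner_int i (add_list (power_list 3 ?r v 4) (power_list 3 ?r w 4)) = 0"
      using that(2) by (simp add: v w horner_int_add horner_int_power)
    then have "reduce_list 3 ?r (add_list (power_list 3 ?r v 4) (power_list 3 ?r w 4)) = map (\<lambda>_. 0) ?r"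
      unfolding horner_int_eq_0_iff .
    moreover have "reduce_list 3 ?r (?K v w) = map (\<lambda>_. 0) ?r"
      using that(1) unfolding v w K[symmetric] horner_int_eq_0_iff .
    moreover have "\<forall>v\<in>set ?V. \<forall>w\<in>set ?V. reduce_list 3 ?r (?K v w) = map (\<lambda>_. 0) ?r \<longrightarrow>
        reduce_list 3 ?r (add_list (power_list 3 ?r v 4) (power_list 3 ?r w 4)) = map (\<lambda>_. 0) ?r \<longrightarrow>
        v = map (\<lambda>_. 0) ?r \<and> w = map (\<lambda>_. 0) ?r"
      by code_simp
    ultimately have "v = map (\<lambda>_. 0) ?r \<and> w = map (\<lambda>_. 0) ?r" using v w by blast
    then show ?thesis unfolding v w by simp
  qed
  let ?F = "\<lambda>v w. add_list (add_list w (mult_list [- 1, 1] v)) (?K v w)"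
  let ?G = "\<lambda>v w. add_list (power_list 3 ?r v 4) (add_list (power_list 3 ?r w 4) [1])"
  let ?P = "\<lambda>x y. y + (i - 1) * x + ?c x y = 0 \<and> x ^ 4 + y ^ 4 + 1 = 0"
  let ?Q = "\<lambda>v w. reduce_list 3 ?r (?F v w) = map (\<lambda>_. 0) ?r \<and>
    reduce_list 3 ?r (?G v w) = map (\<lambda>_. 0) ?r"
  have chart: "eval3 ?C (x, y, 1) = y + (i - 1) * x + ?c x y" for x y
    by (simp add: algebra_simps)
  have "card (rational_points ?C \<inter> rational_points (hermitian_form 3)) =
      card {(x, y, z). (\<lambda>(x, y, z). z) (x, y, z) = 1 \<and> eval3 ?C (x, y, z) = 0 \<and>
        x ^ (3 + 1) + y ^ (3 + 1) + z ^ (3 + 1) = 0}"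
    by (rule card_cubic_hermitian) (use infinity in auto)
  also have "{(x, y, z). (\<lambda>(x, y, z). z) (x, y, z) = 1 \<and> eval3 ?C (x, y, z) = 0 \<and>
        x ^ (3 + 1) + y ^ (3 + 1) + z ^ (3 + 1) = 0} = (\<lambda>(x, y). (x, y, 1)) ` {(x, y). ?P x y}"
    by (auto simp: chart image_iff simp del: eval3_cubic)
  also have "card \<dots> = card {(x, y). ?P x y}" by (rule card_image) (auto simp: inj_on_def)
  also have "\<dots> = length (filter (\<lambda>(v, w). ?Q v w) (List.product ?V ?V))"
  proof (rule card_pairs)
    fix v w
    have "horner_int i (?F v w) = horner_int i w + (i - 1) * horner_int i v
        + ?c (horner_int i v) (horner_int i w)"
      unfolding horner_int_add[of i _ "?K v w"] K
      unfolding horner_int_add horner_int_mult by simp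
    moreover have "horner_int i (?G v w) = horner_int i v ^ 4 + horner_int i w ^ 4 + 1"
      by (simp add: horner_int_add horner_int_power)
    ultimately show "?P (horner_int i v) (horner_int i w) \<longleftrightarrow> ?Q v w"
      by (simp only: flip: horner_int_eq_0_iff)
  qed
  also have "\<dots> = 12" by code_simp
  finally have "card (rational_points ?C \<inter> rational_points (hermitian_form 3)) = 12" .
  moreover have "absolutely_irreducible ?C"
  proof (rule absolutely_irreducible_cubic)
    \<comment> \<open>An identity of integer polynomials in \<open>i\<close>, arranged so that
      \<open>i * i = - 1\<close> and \<open>3 = 0\<close> leave only 1.\<close>
    have "1 + i - (- 1 - i) * (i - 1) + - i * (i - 1) ^ 2 - - i * (i - 1) ^ 3
        = (i * i + 1) * (i * i - 4 * i + 5) + 1 + 3 * (i - 2)"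
      by (simp add: algebra_simps power2_eq_square power3_eq_cube)
    also have "\<dots> = 1" using i2 three by simp
    finally show "1 + i - (- 1 - i) * (i - 1) + - i * (i - 1) ^ 2 - - i * (i - 1) ^ 3 \<noteq> 0"
      by (simp only: one_neq_zero not_False_eq_True)
  qed
  ultimately show ?thesis
    using plane_curve_cubic by (intro exI[of _ ?C]) simp
qed

theorem theorem3p14:
  fixes q :: nat
  assumes "primepow q"
    and "q \<ge> 3"
    and "card (UNIV :: 'a::{field,finite} set) = q ^ 2"
  shows "\<exists>C :: 'a poly3. plane_curve 3 C \<and> absolutely_irreducible C \<and>
           card (rational_points C \<inter> rational_points (hermitian_form q)) = 3 * (q + 1)"
proof -
  \<comment> \<open>Six has two prime divisors, so it is the only value from 3 to 7 that is not a
    prime power.\<close>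
  have "q \<noteq> 6"
  proof
    assume "q = 6"
    with assms(1) obtain p k where p: "prime p" "(6 :: nat) = p ^ k" by (auto simp: primepow_def)
    have "(2 :: nat) dvd p ^ k" "(3 :: nat) dvd p ^ k" unfolding p(2)[symmetric] by simp_all
    moreover have "prime (2 :: nat)" "prime (3 :: nat)" by simp_all
    ultimately have "2 = p" "3 = p"
      using p(1) by (metis prime_dvd_power primes_dvd_imp_eq)+
    then show False by simp
  qed
  then consider "q = 3" | "q = 4" | "q = 5" | "q = 7" | "q \<ge> 8"
    using assms(2) by linarith
  then show ?thesis
    using assms curve_3 curve_4 curve_5 curve_7 curve_ge_8 by cases auto
qed

end
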